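(* Let $\lambda\ge 1$, $\mu\ge 0$ and $t\in(1/2,1)$, and let the function $f(z)=z+\sum_{n=2}^{\infty}a_nz^n$ be in the class $\mathscr{B}_{\Sigma}(\lambda,\mu,t)$. Then $$|a_{2}|\leq \frac{2t\sqrt{2t}}{\sqrt{\left|(1+\lambda+2\mu)^2-4t^{2}\left[(\lambda+2\mu)^2-2\mu\right]\right|}}$$ and $$|a_{3}|\leq \frac{4t^{2}}{(1+\lambda+2\mu)^2}+\frac{2t}{1+2\lambda+6\mu}.$$
   Context: Let $\mathbb{U}=\{z\in\mathbb{C}:|z|<1\}$, and let $\mathscr{A}$ be the class of functions $f(z)=z+\sum_{n=2}^{\infty}a_nz^n$ analytic in $\mathbb{U}$. A function $f\in\mathscr{A}$ is bi-univalent in $\mathbb{U}$ if both $f$ and $f^{-1}$ are univalent in $\mathbb{U}$; here $f^{-1}$ is the local inverse of $f$ near $0$, $f^{-1}(w)=w-a_2w^2+(2a_2^2-a_3)w^3-\cdots$, which is understood to extend to an analytic univalent function on $\mathbb{U}$ (again denoted $f^{-1}$). $\Sigma$ denotes the class of bi-univalent functions in $\mathscr{A}$. For functions $F,G$ analytic in $\mathbb{U}$, $F$ is subordinate to $G$, written $F(z)\prec G(z)$, if there is an analytic $\omega$ on $\mathbb{U}$ with $\omega(0)=0$, $|\omega(z)|<1$ for all $z\in\mathbb{U}$, and $F(z)=G(\omega(z))$ for all $z\in\mathbb{U}$. Let $H(z,t)=\frac{1}{1-2tz+z^2}$ for $z\in\mathbb{U}$ (the generating function of the Chebyshev polynomials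 of the second kind). For $\lambda\ge 1$, $\mu\ge 0$, $t\in(1/2,1)$, the class $\mathscr{B}_{\Sigma}(\lambda,\mu,t)$ consists of all $f\in\Sigma$ such that, with $g=f^{-1}$, $$(1-\lambda)\frac{f(z)}{z}+\lambda f'(z)+\mu zf''(z)\prec H(z,t)\quad\text{and}\quad (1-\lambda)\frac{g(w)}{w}+\lambda g'(w)+\mu wg''(w)\prec H(w,t)$$ on $\mathbb{U}$ (the quotients $f(z)/z$ and $g(w)/w$ take the value $1$ at $0$).
   Formalization: The first bound is asserted only when (1+λ+2μ)² − 4t²[(λ+2μ)² − 2μ] is nonzero; where it vanishes (e.g. λ=2, μ=0, t=3/4) the printed right-hand side divides by zero and is undefined. *)

theory Defs
  imports "HOL-Complex_Analysis.Complex_Analysis"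
begin

abbreviation unit_disc :: "complex set" where
  "unit_disc \<equiv> ball 0 1"

text \<open>Only the values \<open>a n\<close> with \<open>n \<ge> 2\<close> matter: \<open>f z = z + a 2 * z ^ 2 + a 3 * z ^ 3 + \<dots>\<close>.\<close>

definition normalized_expansion :: "(complex \<Rightarrow> complex) \<Rightarrow> (nat \<Rightarrow> complex) \<Rightarrow> bool" where
  "normalized_expansion f a \<longleftrightarrow>
     (\<forall>z\<in>unit_disc. (\<lambda>n. a (n + 2) * z ^ (n + 2)) sums (f z - z))"

definition class_A :: "(complex \<Rightarrow> complex) set" where
  "class_A = {f. f holomorphic_on unit_disc \<and> (\<exists>a. normalized_expansion f a)}"

definition univalent :: "(complex \<Rightarrow> complex) \<Rightarrow> bool" where
  "univalent f \<longleftrightarrow> f holomorphic_on unit_disc \<and> inj_on f unit_disc"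

text \<open>\<open>g\<close> is an analytic function on the unit disc that agrees near \<open>0\<close> with the local inverse
  of \<open>f\<close>. For \<open>f\<close> in \<^const>\<open>class_A\<close>, the identity theorem makes \<open>g\<close> unique on the unit disc,
  so the existential quantifiers over \<open>g\<close> below simply name \<open>f\<close>'s inverse. The image of the unit
  disc under \<open>f\<close> need not contain the unit disc.\<close>

definition extends_local_inverse :: "(complex \<Rightarrow> complex) \<Rightarrow> (complex \<Rightarrow> complex) \<Rightarrow> bool" where
  "extends_local_inverse f g \<longleftrightarrow>
     g holomorphic_on unit_disc \<and> (\<forall>\<^sub>F z in nhds 0. g (f z) = z)"

definition class_Sigma :: "(complex \<Rightarrow> complex) set" where
  "class_Sigma = {f \<in> class_A. univalent f \<and> (\<exists>g. extends_local_inverse f g \<and> univalent g)}"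

definition subordinate :: "(complex \<Rightarrow> complex) \<Rightarrow> (complex \<Rightarrow> complex) \<Rightarrow> bool" where
  "subordinate F G \<longleftrightarrow>
     F holomorphic_on unit_disc \<and> G holomorphic_on unit_disc \<and>
     (\<exists>\<omega>. \<omega> holomorphic_on unit_disc \<and> \<omega> 0 = 0 \<and>
          (\<forall>z\<in>unit_disc. norm (\<omega> z) < 1) \<and> (\<forall>z\<in>unit_disc. F z = G (\<omega> z)))"

definition chebyshev_gen :: "real \<Rightarrow> complex \<Rightarrow> complex" where
  "chebyshev_gen t z = 1 / (1 - 2 * of_real t * z + z ^ 2)"

definition B_operator :: "real \<Rightarrow> real \<Rightarrow> (complex \<Rightarrow> complex) \<Rightarrow> complex \<Rightarrow> complex" where
  "B_operator lam mu f z =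
     (1 - of_real lam) * (if z = 0 then 1 else f z / z) + of_real lam * deriv f z
       + of_real mu * z * deriv (deriv f) z"

definition class_B_Sigma :: "real \<Rightarrow> real \<Rightarrow> real \<Rightarrow> (complex \<Rightarrow> complex) set" where
  "class_B_Sigma lam mu t =
     {f \<in> class_Sigma.
        subordinate (B_operator lam mu f) (chebyshev_gen t) \<and>
        (\<exists>g. extends_local_inverse f g \<and>
             subordinate (B_operator lam mu g) (chebyshev_gen t))}"

end

theory Submission
  imports Defs
begin

text \<open>Write \<open>A = 1 + \<lambda> + 2\<mu>\<close>, \<open>B = 1 + 2\<lambda> + 6\<mu>\<close>, and let \<open>c\<close>, \<open>d\<close> be the Taylor coefficients of the two
  Schwarz functions; by Cauchy's inequality they have modulus at most 1. Since
  \<open>H(z,t) = 1 + 2t z + (4t\<^sup>2 - 1) z\<^sup>2 + \<dots>\<close>, comparing coefficients gives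
  \<open>A a\<^sub>2 = 2t c\<^sub>1\<close>, \<open>B a\<^sub>3 = 2t c\<^sub>2 + (4t\<^sup>2 - 1) c\<^sub>1\<^sup>2\<close> and, for the inverse,
  \<open>- A a\<^sub>2 = 2t d\<^sub>1\<close>, \<open>B (2 a\<^sub>2\<^sup>2 - a\<^sub>3) = 2t d\<^sub>2 + (4t\<^sup>2 - 1) d\<^sub>1\<^sup>2\<close>.
  Hence \<open>d\<^sub>1 = - c\<^sub>1\<close>; the sum of the two second-order equations bounds \<open>a\<^sub>2\<close>, and their difference
  bounds \<open>a\<^sub>3 - a\<^sub>2\<^sup>2\<close>.\<close>

text \<open>Cauchy's inequality on the circle of radius \<open>r < 1\<close> gives
  \<open>norm (fps_nth W n) * r ^ n \<le> 1\<close>. As \<open>w\<close> lives on the open disc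
  only, the bound follows by letting \<open>r\<close> tend to 1 from below.\<close>

lemma norm_fps_nth_le_1:
  assumes holo: "w holomorphic_on unit_disc"
    and bound: "\<And>z. z \<in> unit_disc \<Longrightarrow> norm (w z) \<le> 1"
    and W: "w has_fps_expansion W"
  shows "norm (fps_nth W n) \<le> 1"
proof -
  have le: "norm (fps_nth W n) * r ^ n \<le> 1" if r: "0 < r" "r < 1" for r :: real
  proof -
    have "norm ((deriv ^^ n) w 0) \<le> fact n * 1 / r ^ n"
    proof (rule Cauchy_inequality)
      show "w holomorphic_on ball 0 r"
        using holo by (rule holomorphic_on_subset) (use r in auto)
      show "continuous_on (cball 0 r) w"
        using holomorphic_on_imp_continuous_on[OF holo]
        by (rule continuous_on_subset) (use r in auto)
    qed (use r bound in auto)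
    then show ?thesis
      using r by (simp add: fps_nth_fps_expansion[OF W] norm_divide field_simps)
  qed
  have "((\<lambda>r::real. norm (fps_nth W n) * r ^ n) \<longlongrightarrow> norm (fps_nth W n) * 1 ^ n) (at_left 1)"
    by (intro tendsto_intros)
  moreover have "eventually (\<lambda>r::real. norm (fps_nth W n) * r ^ n \<le> 1) (at_left 1)"
    using eventually_at_left_real[of 0 "1::real", OF zero_less_one] by eventually_elim (use le in auto)
  ultimately show ?thesis
    using tendsto_upperbound[of _ "norm (fps_nth W n) * 1 ^ n" "at_left (1::real)" 1] by simp
qed

text \<open>The values \<open>a 0\<close> and \<open>a 1\<close> are unconstrained, so the
  coefficients 0 and 1 are put in by hand.\<close>

lemma normalized_expansion_imp_fps:
  assumes "normalized_expansion f a"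
  shows "f has_fps_expansion Abs_fps (\<lambda>n. if n = 0 then 0 else if n = 1 then 1 else a n)"
    (is "_ has_fps_expansion Abs_fps ?c")
proof (rule has_fps_expansionI)
  have "(\<lambda>n. ?c n * z ^ n) sums f z" if "z \<in> unit_disc" for z
  proof -
    have "(\<lambda>n. ?c (n + 2) * z ^ (n + 2)) sums (f z - (\<Sum>i<2. ?c i * z ^ i))"
      using assms that by (simp add: normalized_expansion_def numeral_2_eq_2)
    then show ?thesis by (subst (asm) sums_iff_shift) simp
  qed
  moreover have "eventually (\<lambda>z::complex. z \<in> unit_disc) (nhds 0)"
    by (intro eventually_nhds_in_open) auto
  ultimately show "eventually (\<lambda>z. (\<lambda>n. fps_nth (Abs_fps ?c) n * z ^ n) sums f z) (nhds 0)"
    by (auto elim: eventually_mono)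
qed

text \<open>The coefficients of G(F(X)) = X form a triangular system: the n-th equation contains
  \<open>fps_nth G n\<close> with factor \<open>(fps_nth F 1) ^ n = 1\<close>.\<close>

lemma fps_left_inverse_coeffs:
  fixes F G :: "'a :: comm_ring_1 fps"
  assumes "fps_compose G F = fps_X" "fps_nth F 0 = 0" "fps_nth F 1 = 1"
  shows "fps_nth G 1 = 1" "fps_nth G 2 = - fps_nth F 2"
    "fps_nth G 3 = 2 * (fps_nth F 2)\<^sup>2 - fps_nth F 3"
proof -
  have F: "fps_nth F 0 = 0" "fps_nth F (Suc 0) = 1" using assms by auto
  have *: "fps_nth (fps_compose G F) n = fps_nth fps_X n" for n using assms by simp
  note simps = fps_compose_nth fps_mult_nth numeral_2_eq_2 numeral_3_eq_3 power_Suc F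
  show 1: "fps_nth G 1 = 1" using *[of 1] by (simp add: simps)
  show 2: "fps_nth G 2 = - fps_nth F 2" using *[of 2] 1
    by (simp add: simps eq_neg_iff_add_eq_0 add.commute)
  show "fps_nth G 3 = 2 * (fps_nth F 2)\<^sup>2 - fps_nth F 3" using *[of 3] 1 2
    by (simp add: simps algebra_simps)
qed

text \<open>Serves both f and its inverse. Clearing the denominator of the Chebyshev generating
  function turns the subordination into a product of power series, so H itself is never
  expanded.\<close>

lemma subordinate_chebyshev_coeffs:
  assumes F: "f has_fps_expansion F" "fps_nth F 0 = 0" "fps_nth F 1 = 1"
    and sub: "subordinate (B_operator lam mu f) (chebyshev_gen t)"
  obtains c1 c2 :: complex where "norm c1 \<le> 1" "norm c2 \<le> 1"
    "of_real (1 + lam + 2 * mu) * fps_nth F 2 = of_real (2 * t) * c1"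
    "of_real (1 + 2 * lam + 6 * mu) * fps_nth F 3
       = of_real (2 * t) * c2 + of_real (4 * t\<^sup>2 - 1) * c1\<^sup>2"
proof -
  obtain w where holo: "w holomorphic_on unit_disc" and w0: "w 0 = 0"
    and bd: "\<And>z. z \<in> unit_disc \<Longrightarrow> norm (w z) < 1"
    and eq: "\<And>z. z \<in> unit_disc \<Longrightarrow> B_operator lam mu f z = chebyshev_gen t (w z)"
    using sub unfolding subordinate_def by blast
  define W where "W = fps_expansion w 0"
  have W: "w has_fps_expansion W"
    unfolding W_def using holo by (intro has_fps_expansion_fps_expansion) auto
  have W0: "fps_nth W 0 = 0" using has_fps_expansion_imp_0_eq_fps_nth_0[OF W] w0 by simp
  have f0: "f 0 = 0" using has_fps_expansion_imp_0_eq_fps_nth_0[OF F(1)] F(2) by simp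
  define D where "D = 1 - fps_const (2 * of_real t) * W + W ^ 2"
  \<comment> \<open>\<open>P\<close> expands \<open>z * B_operator lam mu f z\<close>; the factor z
    removes the quotient \<open>f z / z\<close>. Its n-th coefficient is 1 + (n-1) lam + n(n-1) mu
    times that of \<open>F\<close>.\<close>
  define P where "P = fps_const (1 - of_real lam) * F + fps_const (of_real lam) * (fps_X * fps_deriv F)
     + fps_const (of_real mu) * (fps_X ^ 2 * fps_deriv (fps_deriv F))"
  let ?d = "\<lambda>z. 1 - 2 * of_real t * w z + w z ^ 2"
  let ?p = "\<lambda>z. (1 - of_real lam) * f z + of_real lam * (z * deriv f z)
              + of_real mu * (z ^ 2 * deriv (deriv f) z)"
  have d: "?d has_fps_expansion D"
    unfolding D_def by (intro fps_expansion_intros W)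
  have p: "?p has_fps_expansion P"
    unfolding P_def by (intro fps_expansion_intros F(1))
  \<comment> \<open>\<open>?d\<close> equals 1 at 0, and an identity near 0 is enough to compare
    coefficients.\<close>
  have "eventually (\<lambda>z. ?d z \<noteq> 0) (nhds 0)"
    using has_fps_expansion_imp_continuous[OF d, of UNIV] w0
    by (intro tendsto_imp_eventually_ne[of _ 1])
       (auto simp: isCont_def tendsto_nhds_iff)
  moreover have "eventually (\<lambda>z::complex. z \<in> unit_disc) (nhds 0)"
    by (intro eventually_nhds_in_open) auto
  ultimately have "eventually (\<lambda>z. ?d z * ?p z = z) (nhds 0)"
  proof eventually_elim
    case (elim z)
    have "?p z = z * B_operator lam mu f z"
      using f0 by (auto simp: B_operator_def algebra_simps power2_eq_square)
    also have "\<dots> = z / ?d z" using eq elim by (simp add: chebyshev_gen_def)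
    finally show ?case using elim by simp
  qed
  then have "(\<lambda>z. z) has_fps_expansion D * P"
    using has_fps_expansion_mult[OF d p] by (subst (asm) has_fps_expansion_cong) auto
  then have DP: "D * P = fps_X"
    using fps_expansion_unique_complex fps_expansion_intros(1) has_fps_expansion_fps_X by blast
  \<comment> \<open>The extra factor z shifts indices: orders 2 and 3 here are orders 1 and 2 of the
    subordination.\<close>
  have c: "fps_nth (D * P) 2 = 0" "fps_nth (D * P) 3 = 0" by (simp_all add: DP)
  have F1: "fps_nth F (Suc 0) = 1" using F by simp
  define c1 c2 where "c1 = fps_nth W 1" and "c2 = fps_nth W 2"
  have D: "fps_nth D 0 = 1" "fps_nth D 1 = - 2 * of_real t * c1"
    "fps_nth D 2 = - 2 * of_real t * c2 + c1\<^sup>2"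
    using W0 by (simp_all add: D_def c1_def c2_def fps_mult_nth numeral_2_eq_2 power_Suc)
  have P: "fps_nth P 0 = 0" "fps_nth P 1 = 1"
    "fps_nth P 2 = of_real (1 + lam + 2 * mu) * fps_nth F 2"
    "fps_nth P 3 = of_real (1 + 2 * lam + 6 * mu) * fps_nth F 3"
    using F(2) F1 by (simp_all add: P_def fps_mult_nth numeral_2_eq_2 numeral_3_eq_3 power_Suc algebra_simps)
  have 2: "fps_nth P 2 = of_real (2 * t) * c1"
    using c(1) D P(1,2) by (simp add: fps_mult_nth numeral_2_eq_2)
  have 3: "fps_nth P 3 = of_real (2 * t) * c2 + of_real (4 * t\<^sup>2 - 1) * c1\<^sup>2"
  proof -
    have "fps_nth P 3 + fps_nth D 1 * fps_nth P 2 + fps_nth D 2 = 0"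
      using c(2) D(1) P(1,2) by (simp add: fps_mult_nth numeral_2_eq_2 numeral_3_eq_3)
    then show ?thesis
      unfolding D 2 of_real_mult of_real_diff of_real_power of_real_numeral of_real_1 by algebra
  qed
  show thesis
  proof (rule that)
    show "norm c1 \<le> 1" "norm c2 \<le> 1"
      unfolding c1_def c2_def using norm_fps_nth_le_1[OF holo _ W] bd by (auto intro: less_imp_le)
  qed (use 2 3 P in auto)
qed

theorem theorem3p1:
  fixes lam mu t :: real and f :: "complex \<Rightarrow> complex" and a :: "nat \<Rightarrow> complex"
  assumes "lam \<ge> 1" and "mu \<ge> 0" and "1 / 2 < t" and "t < 1"
    and "f \<in> class_B_Sigma lam mu t"
    and "normalized_expansion f a"
  shows "((1 + lam + 2 * mu)\<^sup>2 - 4 * t\<^sup>2 * ((lam + 2 * mu)\<^sup>2 - 2 * mu) \<noteq> 0 \<longrightarrow>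
           norm (a 2) \<le> 2 * t * sqrt (2 * t) /
             sqrt \<bar>(1 + lam + 2 * mu)\<^sup>2 - 4 * t\<^sup>2 * ((lam + 2 * mu)\<^sup>2 - 2 * mu)\<bar>) \<and>
         norm (a 3) \<le> 4 * t\<^sup>2 / (1 + lam + 2 * mu)\<^sup>2 + 2 * t / (1 + 2 * lam + 6 * mu)"
proof -
  define A B where "A = 1 + lam + 2 * mu" and "B = 1 + 2 * lam + 6 * mu"
  have pos: "A > 0" "B > 0" "t > 0" using assms by (auto simp: A_def B_def)
  define F where "F = Abs_fps (\<lambda>n. if n = 0 then 0 else if n = 1 then 1 else a n)"
  have F: "f has_fps_expansion F"
    unfolding F_def by (rule normalized_expansion_imp_fps) fact
  have Fn: "fps_nth F 0 = 0" "fps_nth F 1 = 1" "fps_nth F 2 = a 2" "fps_nth F 3 = a 3"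
    by (auto simp: F_def)
  obtain g where g: "g holomorphic_on unit_disc" and inv: "eventually (\<lambda>z. g (f z) = z) (nhds 0)"
    and subf: "subordinate (B_operator lam mu f) (chebyshev_gen t)"
    and subg: "subordinate (B_operator lam mu g) (chebyshev_gen t)"
    using assms(5) unfolding class_B_Sigma_def extends_local_inverse_def by blast
  define G where "G = fps_expansion g 0"
  have G: "g has_fps_expansion G"
    unfolding G_def using g by (intro has_fps_expansion_fps_expansion) auto
  have f0: "f 0 = 0" using has_fps_expansion_imp_0_eq_fps_nth_0[OF F] Fn by simp
  have "g 0 = 0" using eventually_nhds_x_imp_x[OF inv] f0 by simp
  then have G0: "fps_nth G 0 = 0" using has_fps_expansion_imp_0_eq_fps_nth_0[OF G] by simp
  have "(g \<circ> f) has_fps_expansion fps_compose G F"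
    using has_fps_expansion_compose G F Fn(1) by blast
  then have "(\<lambda>z. z) has_fps_expansion fps_compose G F"
    by (subst (asm) has_fps_expansion_cong[of _ "\<lambda>z. z"]) (use inv in auto)
  then have GF: "fps_compose G F = fps_X"
    using fps_expansion_unique_complex has_fps_expansion_fps_X by blast
  note Gn = fps_left_inverse_coeffs[OF GF Fn(1,2), unfolded Fn]
  obtain c1 c2 :: complex where c: "norm c1 \<le> 1" "norm c2 \<le> 1"
    "of_real A * a 2 = of_real (2 * t) * c1"
    "of_real B * a 3 = of_real (2 * t) * c2 + of_real (4 * t\<^sup>2 - 1) * c1\<^sup>2"
    using subordinate_chebyshev_coeffs[OF F Fn(1,2) subf] unfolding A_def B_def Fn by blast
  obtain d1 d2 :: complex where d: "norm d1 \<le> 1" "norm d2 \<le> 1"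
    "of_real A * (- a 2) = of_real (2 * t) * d1"
    "of_real B * (2 * (a 2)\<^sup>2 - a 3) = of_real (2 * t) * d2 + of_real (4 * t\<^sup>2 - 1) * d1\<^sup>2"
    using subordinate_chebyshev_coeffs[OF G G0 Gn(1) subg] unfolding A_def B_def Gn by blast
  have "of_real (2 * t) * (c1 + d1) = 0" unfolding distrib_left c(3)[symmetric] d(3)[symmetric] by simp
  then have d1: "d1 = - c1" using pos by (simp add: add_eq_0_iff)

  let ?D = "A\<^sup>2 - 4 * t\<^sup>2 * ((lam + 2 * mu)\<^sup>2 - 2 * mu)"
  \<comment> \<open>Equivalent to \<open>A\<^sup>2 - B = (lam + 2 * mu)\<^sup>2 - 2 * mu\<close>.
    The right-hand side is the factor of \<open>(a 2)\<^sup>2\<close> that the elimination below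
    produces.\<close>
  have D: "?D = 4 * t\<^sup>2 * B - (4 * t\<^sup>2 - 1) * A\<^sup>2"
    by (simp add: A_def B_def power2_eq_square algebra_simps)
  have sum: "of_real ?D * (a 2)\<^sup>2 = of_real (4 * t ^ 3) * (c2 + d2)"
  proof -
    \<comment> \<open>Adding the second-order equations cancels \<open>a 3\<close>. Multiplying by
      \<open>2 * t\<^sup>2\<close> and replacing \<open>4 * t\<^sup>2 * c1\<^sup>2\<close> by
      \<open>A\<^sup>2 * (a 2)\<^sup>2\<close> then eliminates \<open>c1\<close>.\<close>
    have "2 * of_real B * (a 2)\<^sup>2
        = of_real (2 * t) * (c2 + d2) + 2 * of_real (4 * t\<^sup>2 - 1) * c1\<^sup>2"
      using c(4) d(4) unfolding d1 power2_minus by algebra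
    moreover have "of_real (A\<^sup>2) * (a 2)\<^sup>2 = of_real (4 * t\<^sup>2) * c1\<^sup>2"
      using arg_cong[OF c(3), of "\<lambda>x. x\<^sup>2"] by (simp add: power_mult_distrib)
    ultimately show ?thesis unfolding D of_real_diff of_real_mult of_real_power of_real_numeral of_real_1
      by algebra
  qed
  \<comment> \<open>If \<open>?D = 0\<close>, then \<open>sum\<close> says only that
    \<open>c2 + d2 = 0\<close>, while division by zero would make the bound read
    \<open>a 2 = 0\<close>.\<close>
  have "norm (a 2) \<le> 2 * t * sqrt (2 * t) / sqrt \<bar>?D\<bar>" if "?D \<noteq> 0"
  proof -
    have "\<bar>?D\<bar> * (norm (a 2))\<^sup>2 = 4 * t ^ 3 * norm (c2 + d2)"
      using arg_cong[OF sum, of norm] pos unfolding norm_mult norm_power norm_of_real by simp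
    also have "\<dots> \<le> 4 * t ^ 3 * 2"
      using pos c(2) d(2) by (intro mult_left_mono norm_triangle_le) auto
    finally have "(norm (a 2))\<^sup>2 \<le> 8 * t ^ 3 / \<bar>?D\<bar>"
      using that by (simp add: field_simps)
    also have "\<dots> = (2 * t * sqrt (2 * t) / sqrt \<bar>?D\<bar>)\<^sup>2"
      using pos by (simp add: power_mult_distrib power_divide power2_eq_square power3_eq_cube)
    finally show ?thesis
      by (rule power2_le_imp_le) (use pos in simp)
  qed
  moreover have "norm (a 3) \<le> 4 * t\<^sup>2 / A\<^sup>2 + 2 * t / B"
  proof -
    \<comment> \<open>The bound on \<open>a 3\<close> takes its estimate of \<open>a 2\<close> from
      the first-order equation, independently of \<open>?D\<close>.\<close>
    have "A * norm (a 2) = 2 * t * norm c1"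
      using arg_cong[OF c(3), of norm] pos by (simp add: norm_mult)
    also have "\<dots> \<le> 2 * t * 1" using pos c(1) by (intro mult_left_mono) auto
    finally have "norm (a 2) \<le> 2 * t / A" using pos by (simp add: field_simps)
    then have "(norm (a 2))\<^sup>2 \<le> (2 * t / A)\<^sup>2" by (intro power_mono) auto
    then have a2: "norm ((a 2)\<^sup>2) \<le> 4 * t\<^sup>2 / A\<^sup>2"
      by (simp add: power_divide power_mult_distrib norm_power)
    \<comment> \<open>Subtracting the second-order equations cancels the quadratic terms, since
      \<open>d1\<^sup>2 = c1\<^sup>2\<close>.\<close>
    have "of_real B * (a 3 - (a 2)\<^sup>2) = of_real t * (c2 - d2)"
      using c(4) d(4) unfolding d1 of_real_mult of_real_numeral power2_minus by algebra
    from arg_cong[OF this, of norm] have "B * norm (a 3 - (a 2)\<^sup>2) = t * norm (c2 - d2)"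
      using pos by (simp add: norm_mult)
    also have "\<dots> \<le> t * 2"
      using pos c(2) d(2) norm_triangle_ineq4[of c2 d2] by (intro mult_left_mono) auto
    finally have "norm (a 3 - (a 2)\<^sup>2) \<le> 2 * t / B" using pos by (simp add: field_simps)
    with a2 show ?thesis using norm_triangle_ineq2[of "a 3" "(a 2)\<^sup>2"] by linarith
  qed
  ultimately show ?thesis unfolding A_def B_def by blast
qed

end
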